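(* Let $\tau\in\mathbb{R}_{\ge0}^{|E|T}$ and $\alpha\in[0,1]^{|E|T}$. A feasible flow $y^\star\in\mathcal{Y}_{\mathrm{adm}}$ is a $(\tau,\alpha)$-DBCP equilibrium if and only if $y^\star$ (together with its lane flows $x^\star$) is a minimizer of the convex program $$\min_{y\in\mathcal{Y}_{\mathrm{adm}},\,x\in\mathbb{R}^{2|E|T}}\ \sum_{t\in[T]}\sum_{e\in E}\Big[\sum_{k=1}^2\int_0^{x_{e,k,t}}\ell_e(w)\,dw+\sum_{g\in G_e^I}\frac{y_{e,1,t}^g\tau_{e,t}}{v_t^g}+\sum_{g\in G_e^E}\frac{y_{e,1,t}^g(1-\alpha_{e,t})\tau_{e,t}}{v_t^g}\Big]$$ subject to $x_{e,k,t}=\sum_{g\in G_e}y_{e,k,t}^g$ for all $e\in E,k\in[2],t\in[T]$.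
   Context: Network. $(I,E)$ is a finite acyclic directed graph; $E_i^{\mathrm{in}},E_i^{\mathrm{out}}$ are the edges entering/leaving node $i$. Each edge has two lanes $k\in[2]=\{1,2\}$: an express lane ($k=1$, may be tolled) and a toll-free general-purpose lane ($k=2$). Both lanes of $e$ have the same latency function $\ell_e:\mathbb{R}\to\mathbb{R}$, strictly increasing, convex, nonnegative on $\mathbb{R}_{\ge0}$. Periods are $t\in[T]=\{1,\dots,T\}$. Users. $G=G^E\sqcup G^I$ is a finite set of groups, eligible ($G^E$) or ineligible ($G^I$). Group $g$ has an origin $p_o^g$ and destination $p_d^g$ joined by at least one directed route, a demand $d^g\ge0$, and values of time $v_t^g>0$, $t\in[T]$. $G_e$ is the set of groups having a route from $p_o^g$ to $p_d^g$ containing $e$; $G_e^E=G_e\cap G^E$, $G_e^I=G_e\cap G^I$; $n=\sum_{e}|G_e|$. Flows. A flow is $y=(y_{e,k,t}^g: e\in E,k\in[2],t\in[T],g\in G_e)\in\mathbb{R}_{\ge0}^{2nT}$; $\mathcal{Y}_{\mathrm{adm}}$ is the set of flows such that for all $i\in I,g\in G,t\in[T]$: $d^g\mathbf 1\{i=p_o^g\}+\sum_{e\in E_i^{\mathrm{in}}}\sum_{k}y_{e,k,t}^g=d^g\mathbf 1\{i=p_d^g\}+\sum_{e\in E_i^{\mathrm{out}}}\sum_{k}y_{e,k,t}^g$ (sums over edges with $g\in G_e$). Lane flows: $x_{e,k,t}=\sum_{g\in G_e}y_{e,k,t}^g$. DBCP (discount-based congestion pricing). A policy is $(\tau,\alpha)$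 with tolls $\tau\in\mathbb{R}_{\ge0}^{|E|T}$ and discounts $\alpha\in[0,1]^{|E|T}$. The feasible set is $\mathcal{Y}_{\mathrm{adm}}$. The cost $c_{e,k,t}^g(y)$ is $v_t^g\ell_e(x_{e,1,t})+\tau_{e,t}$ if $k=1,g\in G^I$; $v_t^g\ell_e(x_{e,1,t})+(1-\alpha_{e,t})\tau_{e,t}$ if $k=1,g\in G^E$; $v_t^g\ell_e(x_{e,2,t})$ if $k=2$. A flow $y^\star\in\mathcal{Y}_{\mathrm{adm}}$ is a $(\tau,\alpha)$-DBCP equilibrium if for each $g\in G$ and every $y\in\mathcal{Y}_{\mathrm{adm}}$: $\sum_{e,k,t}(y_{e,k,t}^g-y_{e,k,t}^{g\star})c_{e,k,t}^g(y^\star)\ge0$. *)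

theory Defs
  imports "HOL-Analysis.Analysis" "Graph_Theory.Graph_Theory"
begin

record ('i, 'e, 'g) model =
  network :: "('i, 'e) pre_digraph"
  latency :: "'e \<Rightarrow> real \<Rightarrow> real"
  horizon :: nat
  eligible :: "'g set"
  ineligible :: "'g set"
  origin :: "'g \<Rightarrow> 'i"
  destination :: "'g \<Rightarrow> 'i"
  demand :: "'g \<Rightarrow> real"
  value_of_time :: "'g \<Rightarrow> nat \<Rightarrow> real"

abbreviation nodes :: "('i, 'e, 'g) model \<Rightarrow> 'i set" where
  "nodes M \<equiv> verts (network M)"

abbreviation edges :: "('i, 'e, 'g) model \<Rightarrow> 'e set" where
  "edges M \<equiv> arcs (network M)"

abbreviation periods :: "('i, 'e, 'g) model \<Rightarrow> nat set" where
  "periods M \<equiv> {1..horizon M}"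

abbreviation lanes :: "nat set" where
  "lanes \<equiv> {1, 2}"

definition groups :: "('i, 'e, 'g) model \<Rightarrow> 'g set" where
  "groups M = eligible M \<union> ineligible M"

definition is_route :: "('i, 'e, 'g) model \<Rightarrow> 'g \<Rightarrow> 'e list \<Rightarrow> bool" where
  "is_route M g p \<longleftrightarrow> pre_digraph.awalk (network M) (origin M g) p (destination M g)"

text \<open>The network may have parallel edges. The latency hypotheses are imposed on the nonnegative
  half-line only, so that they cover, for example, a latency of the form \<open>a + b * w ^ 4\<close>, which
  is not monotone on all of the reals.\<close>

locale valid_model =
  fixes M :: "('i, 'e, 'g) model"
  assumes fin_digraph_network: "fin_digraph (network M)"
    and acyclic_network: "\<nexists>p. pre_digraph.cycle (network M) p"
    and latency_strict_mono: "\<And>e. e \<in> edges M \<Longrightarrow> strict_mono_on {0..} (latency M e)"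
    and latency_convex: "\<And>e. e \<in> edges M \<Longrightarrow> convex_on {0..} (latency M e)"
    and latency_nonneg: "\<And>e w. e \<in> edges M \<Longrightarrow> 0 \<le> w \<Longrightarrow> 0 \<le> latency M e w"
    and finite_groups: "finite (groups M)"
    and eligible_ineligible_disjoint: "eligible M \<inter> ineligible M = {}"
    and origin_node: "\<And>g. g \<in> groups M \<Longrightarrow> origin M g \<in> nodes M"
    and destination_node: "\<And>g. g \<in> groups M \<Longrightarrow> destination M g \<in> nodes M"
    and route_exists: "\<And>g. g \<in> groups M \<Longrightarrow> \<exists>p. is_route M g p"
    and demand_nonneg: "\<And>g. g \<in> groups M \<Longrightarrow> 0 \<le> demand M g"
    and value_of_time_pos:
      "\<And>g t. g \<in> groups M \<Longrightarrow> t \<in> periods M \<Longrightarrow> 0 < value_of_time M g t"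

definition groups_on :: "('i, 'e, 'g) model \<Rightarrow> 'e \<Rightarrow> 'g set" where
  "groups_on M e = {g \<in> groups M. \<exists>p. is_route M g p \<and> e \<in> set p}"

text \<open>Vectors of flows are extensional functions on their index sets, so that they are in
  one-to-one correspondence with points of the coordinate spaces. In particular a flow has one
  component \<open>y (e, k, t, g)\<close> for each \<open>g \<in> groups_on M e\<close>, and none for other groups.\<close>

type_synonym ('e, 'g) flow = "'e \<times> nat \<times> nat \<times> 'g \<Rightarrow> real"

type_synonym 'e lane_flow = "'e \<times> nat \<times> nat \<Rightarrow> real"

definition flow_index :: "('i, 'e, 'g) model \<Rightarrow> ('e \<times> nat \<times> nat \<times> 'g) set" where
  "flow_index M =
    {(e, k, t, g). e \<in> edges M \<and> k \<in> lanes \<and> t \<in> periods M \<and> g \<in> groups_on M e}"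

definition flows :: "('i, 'e, 'g) model \<Rightarrow> ('e, 'g) flow set" where
  "flows M = (flow_index M \<rightarrow>\<^sub>E {0..})"

definition admissible :: "('i, 'e, 'g) model \<Rightarrow> ('e, 'g) flow set" where
  "admissible M = {y \<in> flows M. \<forall>i \<in> nodes M. \<forall>g \<in> groups M. \<forall>t \<in> periods M.
      demand M g * of_bool (i = origin M g)
        + (\<Sum>e \<in> {e \<in> in_arcs (network M) i. g \<in> groups_on M e}. \<Sum>k \<in> lanes. y (e, k, t, g))
      = demand M g * of_bool (i = destination M g)
        + (\<Sum>e \<in> {e \<in> out_arcs (network M) i. g \<in> groups_on M e}. \<Sum>k \<in> lanes. y (e, k, t, g))}"

definition lane_flow_index :: "('i, 'e, 'g) model \<Rightarrow> ('e \<times> nat \<times> nat) set" where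
  "lane_flow_index M = edges M \<times> lanes \<times> periods M"

definition lane_flow :: "('i, 'e, 'g) model \<Rightarrow> ('e, 'g) flow \<Rightarrow> 'e lane_flow" where
  "lane_flow M y = (\<lambda>(e, k, t) \<in> lane_flow_index M. \<Sum>g \<in> groups_on M e. y (e, k, t, g))"

definition is_policy ::
  "('i, 'e, 'g) model \<Rightarrow> ('e \<Rightarrow> nat \<Rightarrow> real) \<Rightarrow> ('e \<Rightarrow> nat \<Rightarrow> real) \<Rightarrow> bool" where
  "is_policy M \<tau> \<alpha> \<longleftrightarrow>
    (\<forall>e \<in> edges M. \<forall>t \<in> periods M. 0 \<le> \<tau> e t \<and> 0 \<le> \<alpha> e t \<and> \<alpha> e t \<le> 1)"

definition cost ::
  "('i, 'e, 'g) model \<Rightarrow> ('e \<Rightarrow> nat \<Rightarrow> real) \<Rightarrow> ('e \<Rightarrow> nat \<Rightarrow> real) \<Rightarrow> ('e, 'g) flow \<Rightarrow>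
    'e \<Rightarrow> nat \<Rightarrow> nat \<Rightarrow> 'g \<Rightarrow> real" where
  "cost M \<tau> \<alpha> y e k t g =
    (if k = 1 then
       if g \<in> ineligible M then
         value_of_time M g t * latency M e (lane_flow M y (e, 1, t)) + \<tau> e t
       else
         value_of_time M g t * latency M e (lane_flow M y (e, 1, t)) + (1 - \<alpha> e t) * \<tau> e t
     else value_of_time M g t * latency M e (lane_flow M y (e, 2, t)))"

definition dbcp_equilibrium ::
  "('i, 'e, 'g) model \<Rightarrow> ('e \<Rightarrow> nat \<Rightarrow> real) \<Rightarrow> ('e \<Rightarrow> nat \<Rightarrow> real) \<Rightarrow> ('e, 'g) flow \<Rightarrow> bool" where
  "dbcp_equilibrium M \<tau> \<alpha> y' \<longleftrightarrow> y' \<in> admissible M \<and>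
    (\<forall>g \<in> groups M. \<forall>y \<in> admissible M.
      (\<Sum>e \<in> {e \<in> edges M. g \<in> groups_on M e}. \<Sum>k \<in> lanes. \<Sum>t \<in> periods M.
        (y (e, k, t, g) - y' (e, k, t, g)) * cost M \<tau> \<alpha> y' e k t g) \<ge> 0)"

definition program_objective ::
  "('i, 'e, 'g) model \<Rightarrow> ('e \<Rightarrow> nat \<Rightarrow> real) \<Rightarrow> ('e \<Rightarrow> nat \<Rightarrow> real) \<Rightarrow>
    ('e, 'g) flow \<times> 'e lane_flow \<Rightarrow> real" where
  "program_objective M \<tau> \<alpha> = (\<lambda>(y, x).
    \<Sum>t \<in> periods M. \<Sum>e \<in> edges M.
      (\<Sum>k \<in> lanes. LBINT w=0..ereal (x (e, k, t)). latency M e w)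
      + (\<Sum>g \<in> groups_on M e \<inter> ineligible M. y (e, 1, t, g) * \<tau> e t / value_of_time M g t)
      + (\<Sum>g \<in> groups_on M e \<inter> eligible M.
          y (e, 1, t, g) * (1 - \<alpha> e t) * \<tau> e t / value_of_time M g t))"

definition program_feasible ::
  "('i, 'e, 'g) model \<Rightarrow> ('e, 'g) flow \<times> 'e lane_flow \<Rightarrow> bool" where
  "program_feasible M = (\<lambda>(y, x).
    y \<in> admissible M \<and> x \<in> (lane_flow_index M \<rightarrow>\<^sub>E UNIV) \<and>
    (\<forall>e \<in> edges M. \<forall>k \<in> lanes. \<forall>t \<in> periods M.
      x (e, k, t) = (\<Sum>g \<in> groups_on M e. y (e, k, t, g))))"

end

theory Submission
  imports Defs
begin

text \<open>Taking deviations in a single period and by a single group, and dividing by the value of time,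
  shows that an equilibrium is a solution of the variational inequality
  \<open>D y z \<ge> 0\<close>, where \<open>D y z\<close> is the formal directional derivative of the program objective at
  \<open>y\<close> towards \<open>z\<close>. Since latencies are nondecreasing, \<open>D y z\<close> bounds the increase of the objective
  from below, so a solution is a minimizer. Conversely, on the segment from a minimizer to \<open>z\<close> the
  increase is bounded above by its length times the same expression with the latencies evaluated at
  the far end point, and one lets that end point tend to the minimizer.\<close>

section \<open>Continuity and integrals of monotone functions on a half-line\<close>

text \<open>Convexity alone would allow a jump at the end point \<open>a\<close>.\<close>

lemma convex_mono_continuous_on_atLeast:
  fixes f :: "real \<Rightarrow> real"
  assumes "convex_on {a..} f" and "mono_on {a..} f"
  shows "continuous_on {a..} f"
proof -
  have open_part: "continuous_on {a<..} f"
    by (intro convex_on_continuous convex_on_subset[OF assms(1)]) auto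
  have at_a: "(f \<longlongrightarrow> f a) (at a within {a..})"
  \<comment> \<open>Monotonicity bounds \<open>f\<close> from below by \<open>f a\<close>, convexity
    from above by the chord over \<open>[a, a + 1]\<close>; both bounds tend to
    \<open>f a\<close>.\<close>
  proof (rule real_tendsto_sandwich)
    show "eventually (\<lambda>x. f a \<le> f x) (at a within {a..})"
      using assms(2) by (auto simp: eventually_at_filter mono_on_def)
    show "eventually (\<lambda>x. f x \<le> (1 - (x - a)) * f a + (x - a) * f (a + 1)) (at a within {a..})"
      unfolding eventually_at
    proof (intro exI[of _ 1] conjI ballI impI)
      fix x assume x: "x \<in> {a..}" "x \<noteq> a \<and> dist x a < 1"
      then have "f ((1 - (x - a)) *\<^sub>R a + (x - a) *\<^sub>R (a + 1)) \<le> (1 - (x - a)) * f a + (x - a) * f (a + 1)"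
        by (intro convex_onD[OF assms(1)]) (auto simp: dist_real_def)
      then show "f x \<le> (1 - (x - a)) * f a + (x - a) * f (a + 1)"
        by (simp add: algebra_simps)
    qed simp
    show "((\<lambda>x. (1 - (x - a)) * f a + (x - a) * f (a + 1)) \<longlongrightarrow> f a) (at a within {a..})"
      by (auto intro!: tendsto_eq_intros)
  qed auto
  show ?thesis
    unfolding continuous_on_def
  proof
    fix x assume "x \<in> {a..}"
    then consider "x = a" | "a < x" by fastforce
    then show "(f \<longlongrightarrow> f x) (at x within {a..})"
    proof cases
      case 2
      then have "(f \<longlongrightarrow> f x) (at x)"
        using open_part by (auto simp: continuous_on_eq_continuous_at isCont_def)
      then show ?thesis
        by (rule filterlim_mono) (auto simp: at_le)
    qed (use at_a in simp)
  qed
qed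

text \<open>A nondecreasing integrand is at least \<open>f a\<close> to the right of
  \<open>a\<close> and at most \<open>f a\<close> to the left, so \<open>f a\<close> is a
  subgradient at \<open>a\<close> of the primitive. No sign of \<open>b - a\<close> is fixed:
  exchanging \<open>a\<close> and \<open>b\<close> then gives the matching upper bound with
  \<open>f b\<close>.\<close>

lemma interval_integral_mono_subgradient:
  fixes f :: "real \<Rightarrow> real"
  assumes cont: "continuous_on {0..} f" and mono: "mono_on {0..} f"
    and "0 \<le> a" "0 \<le> b"
  shows "(b - a) * f a \<le> (LBINT w=0..ereal b. f w) - (LBINT w=0..ereal a. f w)"
proof -
  have int: "f integrable_on {c..d}" if "0 \<le> c" for c d
    by (intro integrable_continuous_interval continuous_on_subset[OF cont]) (use that in auto)
  \<comment> \<open>The Lebesgue interval integral is turned into the gauge integral, where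
    splitting and comparison of integrals are carried out.\<close>
  have conv: "(LBINT w=0..ereal c. f w) = integral {0..c} f" if "0 \<le> c" for c
  proof -
    have "set_integrable lborel {0..c} f"
      by (intro borel_integrable_atLeastAtMost' continuous_on_subset[OF cont]) auto
    then show ?thesis
      using interval_integral_eq_integral[of 0 c f] that by (simp add: zero_ereal_def)
  qed
  have comb: "integral {0..d} f = integral {0..c} f + integral {c..d} f" if "0 \<le> c" "c \<le> d" for c d
    using Henstock_Kurzweil_Integration.integral_combine[OF that int[of 0 d]] by simp
  show ?thesis
  proof (cases "a \<le> b")
    case True
    have "integral {a..b} (\<lambda>_. f a) \<le> integral {a..b} f"
      using mono \<open>0 \<le> a\<close> by (intro integral_le int) (auto simp: mono_on_def)
    then show ?thesis
      using True comb[of a b] conv assms by simp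
  next
    case False
    have "integral {b..a} f \<le> integral {b..a} (\<lambda>_. f a)"
      using mono \<open>0 \<le> b\<close> by (intro integral_le int) (auto simp: mono_on_def)
    then show ?thesis
      using False comb[of b a] conv assms by (simp add: algebra_simps)
  qed
qed

section \<open>Convex combinations of flows\<close>

text \<open>The feasible set is a product over pairs of a period and a group, so the weight of a
  convex combination of two flows may be chosen separately for each pair.\<close>

definition mix ::
  "('i, 'e, 'g) model \<Rightarrow> (nat \<Rightarrow> 'g \<Rightarrow> real) \<Rightarrow> ('e, 'g) flow \<Rightarrow> ('e, 'g) flow \<Rightarrow> ('e, 'g) flow" where
  "mix M w y z =
    (\<lambda>(e, k, t, g) \<in> flow_index M. y (e, k, t, g) + w t g * (z (e, k, t, g) - y (e, k, t, g)))"

lemma mix_apply: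
  assumes "e \<in> edges M" "k \<in> lanes" "t \<in> periods M" "g \<in> groups_on M e"
  shows "mix M w y z (e, k, t, g) = y (e, k, t, g) + w t g * (z (e, k, t, g) - y (e, k, t, g))"
  using assms by (simp add: mix_def flow_index_def)

lemma flow_nonneg:
  assumes "y \<in> flows M" "e \<in> edges M" "k \<in> lanes" "t \<in> periods M" "g \<in> groups_on M e"
  shows "0 \<le> y (e, k, t, g)"
proof -
  have "(e, k, t, g) \<in> flow_index M" using assms by (simp add: flow_index_def)
  then show ?thesis using assms(1) by (auto simp: flows_def dest: PiE_mem)
qed

lemma lane_flow_apply:
  assumes "e \<in> edges M" "k \<in> lanes" "t \<in> periods M"
  shows "lane_flow M y (e, k, t) = (\<Sum>g \<in> groups_on M e. y (e, k, t, g))"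
  using assms by (simp add: lane_flow_def lane_flow_index_def)

lemma lane_flow_nonneg:
  assumes "y \<in> flows M" "e \<in> edges M" "k \<in> lanes" "t \<in> periods M"
  shows "0 \<le> lane_flow M y (e, k, t)"
  using assms by (auto simp: lane_flow_apply intro!: sum_nonneg flow_nonneg)

text \<open>The weight is constant here because a lane flow sums over groups, and a weight that
  varies with the group could not be pulled out of that sum.\<close>

lemma lane_flow_mix:
  assumes "e \<in> edges M" "k \<in> lanes" "t \<in> periods M"
  shows "lane_flow M (mix M (\<lambda>_ _. s) y z) (e, k, t) =
    lane_flow M y (e, k, t) + s * (lane_flow M z (e, k, t) - lane_flow M y (e, k, t))"
  using assms
  by (simp add: lane_flow_apply mix_apply sum.distrib sum_subtractf sum_distrib_left[symmetric]
      cong: sum.cong)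

lemma mix_flows:
  assumes "y \<in> flows M" "z \<in> flows M" "\<And>t g. 0 \<le> w t g \<and> w t g \<le> 1"
  shows "mix M w y z \<in> flows M"
proof -
  have "0 \<le> y i + c * (z i - y i)" if "i \<in> flow_index M" "0 \<le> c" "c \<le> 1" for i c
  proof -
    have "0 \<le> y i" "0 \<le> z i" using assms that by (auto simp: flows_def dest: PiE_mem)
    then have "0 \<le> (1 - c) * y i + c * z i" using that by simp
    then show ?thesis by (simp add: algebra_simps)
  qed
  then show ?thesis using assms(3) by (auto simp: flows_def mix_def)
qed

text \<open>Each balance equation involves a single period and a single group, so within it the
  weight \<open>w t g\<close> is one number and the equation is preserved by affine
  combination.\<close>

lemma mix_admissible:
  assumes "y \<in> admissible M" "z \<in> admissible M" "\<And>t g. 0 \<le> w t g \<and> w t g \<le> 1"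
  shows "mix M w y z \<in> admissible M"
proof -
  have "demand M g * of_bool (i = origin M g)
        + (\<Sum>e \<in> {e \<in> in_arcs (network M) i. g \<in> groups_on M e}. \<Sum>k \<in> lanes. mix M w y z (e, k, t, g))
      = demand M g * of_bool (i = destination M g)
        + (\<Sum>e \<in> {e \<in> out_arcs (network M) i. g \<in> groups_on M e}. \<Sum>k \<in> lanes. mix M w y z (e, k, t, g))"
    (is "?o + ?in (mix M w y z) = ?d + ?out (mix M w y z)")
    if i: "i \<in> nodes M" and g: "g \<in> groups M" and t: "t \<in> periods M" for i g t
  proof -
    have sum_mix: "(\<Sum>e\<in>A. \<Sum>k\<in>lanes. mix M w y z (e, k, t, g)) =
        (\<Sum>e\<in>A. \<Sum>k\<in>lanes. y (e, k, t, g)) + w t g *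
          ((\<Sum>e\<in>A. \<Sum>k\<in>lanes. z (e, k, t, g)) - (\<Sum>e\<in>A. \<Sum>k\<in>lanes. y (e, k, t, g)))"
      if "A \<subseteq> {e \<in> edges M. g \<in> groups_on M e}" for A
    proof -
      have "(\<Sum>e\<in>A. \<Sum>k\<in>lanes. mix M w y z (e, k, t, g)) =
        (\<Sum>e\<in>A. \<Sum>k\<in>lanes. y (e, k, t, g) + w t g * (z (e, k, t, g) - y (e, k, t, g)))"
        using that t by (intro sum.cong refl mix_apply) auto
      then show ?thesis
        by (simp only: sum.distrib sum_subtractf sum_distrib_left[symmetric])
    qed
    have bal: "?o + ?in u = ?d + ?out u" if "u \<in> admissible M" for u
      using that i g t unfolding admissible_def by blast
    \<comment> \<open>The demand terms do not depend on the flow and cancel in the difference of the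
      two balance equations.\<close>
    have diff: "?in z - ?in y = ?out z - ?out y"
      using bal[OF assms(1)] bal[OF assms(2)] by linarith
    have "?in (mix M w y z) = ?in y + w t g * (?in z - ?in y)"
      "?out (mix M w y z) = ?out y + w t g * (?out z - ?out y)"
      by (rule sum_mix; auto)+
    with diff bal[OF assms(1)] show ?thesis
      by simp
  qed
  then show ?thesis
    using assms mix_flows[of y M z w] by (simp add: admissible_def)
qed

section \<open>Elimination of the lane flows from the program\<close>

lemma lane_flow_extensional: "lane_flow M y \<in> (lane_flow_index M \<rightarrow>\<^sub>E UNIV)"
  by (simp add: lane_flow_def)

text \<open>Extensionality fixes \<open>x\<close> outside the index set and the constraints fix it
  inside, so the program is a minimization over \<open>y\<close> alone.\<close>

lemma program_feasible_iff:
  "program_feasible M (y, x) \<longleftrightarrow> y \<in> admissible M \<and> x = lane_flow M y"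
proof
  assume f: "program_feasible M (y, x)"
  then have "x \<in> (lane_flow_index M \<rightarrow>\<^sub>E UNIV)"
    unfolding program_feasible_def prod.case by blast
  then have "x = lane_flow M y"
  proof (rule PiE_ext[OF _ lane_flow_extensional])
    fix i assume "i \<in> lane_flow_index M"
    then obtain e k t where "i = (e, k, t)" "e \<in> edges M" "k \<in> lanes" "t \<in> periods M"
      unfolding lane_flow_index_def by blast
    with f show "x i = lane_flow M y i"
      unfolding program_feasible_def prod.case by (simp only: lane_flow_apply)
  qed
  with f show "y \<in> admissible M \<and> x = lane_flow M y" by (simp add: program_feasible_def)
next
  assume "y \<in> admissible M \<and> x = lane_flow M y"
  then show "program_feasible M (y, x)"
    unfolding program_feasible_def prod.case by (metis lane_flow_extensional lane_flow_apply)
qed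

section \<open>Costs of deviations by one group in one period\<close>

definition toll ::
  "('i, 'e, 'g) model \<Rightarrow> ('e \<Rightarrow> nat \<Rightarrow> real) \<Rightarrow> ('e \<Rightarrow> nat \<Rightarrow> real) \<Rightarrow> 'e \<Rightarrow> nat \<Rightarrow> 'g \<Rightarrow> real" where
  "toll M \<tau> \<alpha> e t g = (if g \<in> ineligible M then \<tau> e t else (1 - \<alpha> e t) * \<tau> e t)"

definition deviation_cost ::
  "('i, 'e, 'g) model \<Rightarrow> ('e \<Rightarrow> nat \<Rightarrow> real) \<Rightarrow> ('e \<Rightarrow> nat \<Rightarrow> real) \<Rightarrow>
    ('e, 'g) flow \<Rightarrow> ('e, 'g) flow \<Rightarrow> nat \<Rightarrow> 'g \<Rightarrow> real" where
  "deviation_cost M \<tau> \<alpha> y z t g =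
    (\<Sum>e \<in> {e \<in> edges M. g \<in> groups_on M e}. \<Sum>k \<in> lanes.
      (z (e, k, t, g) - y (e, k, t, g)) * cost M \<tau> \<alpha> y e k t g)"

text \<open>Costs are frozen at \<open>y\<close>, so the expression is linear in the deviation from
  \<open>y\<close>.\<close>

lemma deviation_cost_mix:
  assumes "t \<in> periods M"
  shows "deviation_cost M \<tau> \<alpha> y (mix M w y z) t g = w t g * deviation_cost M \<tau> \<alpha> y z t g"
proof -
  have "deviation_cost M \<tau> \<alpha> y (mix M w y z) t g =
    (\<Sum>e \<in> {e \<in> edges M. g \<in> groups_on M e}. \<Sum>k \<in> lanes.
      w t g * ((z (e, k, t, g) - y (e, k, t, g)) * cost M \<tau> \<alpha> y e k t g))"
    unfolding deviation_cost_def using assms by (intro sum.cong refl) (simp add: mix_apply)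
  then show ?thesis by (simp only: deviation_cost_def sum_distrib_left)
qed

text \<open>The definition of equilibrium sums over periods; since a deviation may be confined to
  one period, the sum is nonnegative for all deviations only if each period contributes a
  nonnegative amount.\<close>

lemma dbcp_equilibrium_iff_deviation_cost:
  assumes "y \<in> admissible M"
  shows "dbcp_equilibrium M \<tau> \<alpha> y \<longleftrightarrow>
    (\<forall>z \<in> admissible M. \<forall>g \<in> groups M. \<forall>t \<in> periods M. 0 \<le> deviation_cost M \<tau> \<alpha> y z t g)"
    (is "_ \<longleftrightarrow> ?R")
proof -
  have swap: "(\<Sum>e \<in> {e \<in> edges M. g \<in> groups_on M e}. \<Sum>k \<in> lanes. \<Sum>t \<in> periods M.
      (z (e, k, t, g) - y (e, k, t, g)) * cost M \<tau> \<alpha> y e k t g) =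
      (\<Sum>t \<in> periods M. deviation_cost M \<tau> \<alpha> y z t g)" for z g
    unfolding deviation_cost_def by (subst (2) sum.swap, subst sum.swap) (rule refl)
  have eq: "dbcp_equilibrium M \<tau> \<alpha> y \<longleftrightarrow>
    (\<forall>g \<in> groups M. \<forall>z \<in> admissible M. 0 \<le> (\<Sum>t \<in> periods M. deviation_cost M \<tau> \<alpha> y z t g))"
    using assms by (simp only: dbcp_equilibrium_def swap simp_thms)
  show ?thesis
  proof
    assume E: "dbcp_equilibrium M \<tau> \<alpha> y"
    show ?R
    proof (intro ballI)
      fix z g t assume z: "z \<in> admissible M" and g: "g \<in> groups M" and t: "t \<in> periods M"
      \<comment> \<open>\<open>u\<close> follows \<open>z\<close> in period \<open>t\<close> and
        \<open>y\<close> in all other periods.\<close>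
      define u where "u = mix M (\<lambda>s _. of_bool (s = t)) y z"
      have "u \<in> admissible M" unfolding u_def using assms z by (intro mix_admissible) auto
      with E g have "0 \<le> (\<Sum>s \<in> periods M. deviation_cost M \<tau> \<alpha> y u s g)" by (simp add: eq)
      also have "\<dots> = (\<Sum>s \<in> periods M. of_bool (s = t) * deviation_cost M \<tau> \<alpha> y z s g)"
        unfolding u_def by (intro sum.cong refl deviation_cost_mix)
      also have "\<dots> = deviation_cost M \<tau> \<alpha> y z t g"
        using t by (simp add: sum.remove[of _ t])
      finally show "0 \<le> deviation_cost M \<tau> \<alpha> y z t g" .
    qed
  qed (auto simp: eq intro!: sum_nonneg)
qed

section \<open>The potential and its first-order bounds\<close>

context valid_model
begin

lemma finite_edges [simp]: "finite (edges M)"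
  using fin_digraph.finite_arcs[OF fin_digraph_network] .

lemma groups_on_subset: "groups_on M e \<subseteq> groups M"
  by (auto simp: groups_on_def)

lemma finite_groups_on [simp]: "finite (groups_on M e)"
  by (rule finite_subset[OF groups_on_subset finite_groups])

lemma latency_mono_on: "e \<in> edges M \<Longrightarrow> mono_on {0..} (latency M e)"
  by (intro strict_mono_on_imp_mono_on latency_strict_mono)

lemma latency_continuous_on: "e \<in> edges M \<Longrightarrow> continuous_on {0..} (latency M e)"
  by (intro convex_mono_continuous_on_atLeast latency_convex latency_mono_on)

definition potential :: "('e \<Rightarrow> nat \<Rightarrow> real) \<Rightarrow> ('e \<Rightarrow> nat \<Rightarrow> real) \<Rightarrow> ('e, 'g) flow \<Rightarrow> real" where
  "potential \<tau> \<alpha> y = program_objective M \<tau> \<alpha> (y, lane_flow M y)"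

text \<open>The toll terms of the objective are linear in the flow, so this is both their exact
  increase from \<open>y\<close> to \<open>z\<close> and their directional derivative.\<close>

definition toll_change ::
  "('e \<Rightarrow> nat \<Rightarrow> real) \<Rightarrow> ('e \<Rightarrow> nat \<Rightarrow> real) \<Rightarrow> ('e, 'g) flow \<Rightarrow> ('e, 'g) flow \<Rightarrow> real" where
  "toll_change \<tau> \<alpha> y z = (\<Sum>t \<in> periods M. \<Sum>e \<in> edges M. \<Sum>g \<in> groups_on M e.
    (z (e, 1, t, g) - y (e, 1, t, g)) * toll M \<tau> \<alpha> e t g / value_of_time M g t)"

lemma toll_change_mix: "toll_change \<tau> \<alpha> y (mix M (\<lambda>_ _. s) y z) = s * toll_change \<tau> \<alpha> y z"
proof -
  have "toll_change \<tau> \<alpha> y (mix M (\<lambda>_ _. s) y z) =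
    (\<Sum>t \<in> periods M. \<Sum>e \<in> edges M. \<Sum>g \<in> groups_on M e.
      s * ((z (e, 1, t, g) - y (e, 1, t, g)) * toll M \<tau> \<alpha> e t g / value_of_time M g t))"
    unfolding toll_change_def by (intro sum.cong refl) (simp add: mix_apply)
  then show ?thesis by (simp only: toll_change_def sum_distrib_left)
qed

text \<open>Eligible and ineligible groups partition the groups on an edge, so the two toll sums of
  the objective merge into one sum with the group-dependent \<open>toll\<close>.\<close>

lemma potential_eq:
  "potential \<tau> \<alpha> y = (\<Sum>t \<in> periods M. \<Sum>e \<in> edges M.
    (\<Sum>k \<in> lanes. LBINT w=0..ereal (lane_flow M y (e, k, t)). latency M e w)
    + (\<Sum>g \<in> groups_on M e. y (e, 1, t, g) * toll M \<tau> \<alpha> e t g / value_of_time M g t))"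
proof -
  have split: "sum f (groups_on M e) =
      sum f (groups_on M e \<inter> ineligible M) + sum f (groups_on M e \<inter> eligible M)" for f e
  proof -
    have "groups_on M e = (groups_on M e \<inter> ineligible M) \<union> (groups_on M e \<inter> eligible M)"
      by (auto simp: groups_on_def groups_def)
    then show ?thesis
      using eligible_ineligible_disjoint
      by (subst \<open>groups_on M e = _\<close>, subst sum.union_disjoint) auto
  qed
  have el: "(\<Sum>g \<in> groups_on M e \<inter> eligible M. y (e, 1, t, g) * toll M \<tau> \<alpha> e t g / value_of_time M g t)
    = (\<Sum>g \<in> groups_on M e \<inter> eligible M.
          y (e, 1, t, g) * (1 - \<alpha> e t) * \<tau> e t / value_of_time M g t)" for e t
    using eligible_ineligible_disjoint by (intro sum.cong) (auto simp: toll_def)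
  have inel: "(\<Sum>g \<in> groups_on M e \<inter> ineligible M. y (e, 1, t, g) * toll M \<tau> \<alpha> e t g / value_of_time M g t)
    = (\<Sum>g \<in> groups_on M e \<inter> ineligible M. y (e, 1, t, g) * \<tau> e t / value_of_time M g t)" for e t
    by (intro sum.cong) (auto simp: toll_def)
  show ?thesis
    unfolding potential_def program_objective_def prod.case
    by (simp only: split el inel add.assoc)
qed

lemma potential_diff:
  "potential \<tau> \<alpha> z - potential \<tau> \<alpha> y = (\<Sum>t \<in> periods M. \<Sum>e \<in> edges M. \<Sum>k \<in> lanes.
      (LBINT w=0..ereal (lane_flow M z (e, k, t)). latency M e w)
      - (LBINT w=0..ereal (lane_flow M y (e, k, t)). latency M e w)) + toll_change \<tau> \<alpha> y z"
  unfolding potential_eq toll_change_def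
  by (simp only: sum.distrib sum_subtractf left_diff_distrib diff_divide_distrib)

text \<open>The subgradient inequality is applied on each edge, lane and period; the toll part is
  exact.\<close>

lemma potential_diff_ge:
  assumes "y \<in> flows M" "z \<in> flows M"
  shows "(\<Sum>t \<in> periods M. \<Sum>e \<in> edges M. \<Sum>k \<in> lanes.
      (lane_flow M z (e, k, t) - lane_flow M y (e, k, t)) * latency M e (lane_flow M y (e, k, t)))
      + toll_change \<tau> \<alpha> y z \<le> potential \<tau> \<alpha> z - potential \<tau> \<alpha> y"
  unfolding potential_diff using assms
  by (intro add_right_mono sum_mono interval_integral_mono_subgradient
      latency_continuous_on latency_mono_on lane_flow_nonneg) auto

text \<open>The subgradient inequality is based at the lane flow of \<open>z\<close> instead, which
  reverses the estimate and moves the latencies to the far end.\<close>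

lemma potential_diff_le:
  assumes "y \<in> flows M" "z \<in> flows M"
  shows "potential \<tau> \<alpha> z - potential \<tau> \<alpha> y \<le> (\<Sum>t \<in> periods M. \<Sum>e \<in> edges M. \<Sum>k \<in> lanes.
      (lane_flow M z (e, k, t) - lane_flow M y (e, k, t)) * latency M e (lane_flow M z (e, k, t)))
      + toll_change \<tau> \<alpha> y z"
proof -
  have "(LBINT w=0..ereal b. latency M e w) - (LBINT w=0..ereal a. latency M e w)
      \<le> (b - a) * latency M e b" if "e \<in> edges M" "0 \<le> a" "0 \<le> b" for e a b
    using interval_integral_mono_subgradient[OF latency_continuous_on latency_mono_on, of e b a] that
    by (simp add: algebra_simps)
  then show ?thesis
    unfolding potential_diff using assms
    by (intro add_right_mono sum_mono) (simp only: lane_flow_nonneg)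
qed

section \<open>Equilibria as solutions of a variational inequality\<close>

text \<open>Dividing by the value of time makes the latency part of the cost independent of the group,
  so that the sum over groups collapses to lane flows.\<close>

lemma sum_deviation_cost:
  "(\<Sum>t \<in> periods M. \<Sum>g \<in> groups M. deviation_cost M \<tau> \<alpha> y z t g / value_of_time M g t) =
    (\<Sum>t \<in> periods M. \<Sum>e \<in> edges M. \<Sum>k \<in> lanes.
      (lane_flow M z (e, k, t) - lane_flow M y (e, k, t)) * latency M e (lane_flow M y (e, k, t)))
    + toll_change \<tau> \<alpha> y z"
proof -
  have "(\<Sum>g \<in> groups M. deviation_cost M \<tau> \<alpha> y z t g / value_of_time M g t) =
    (\<Sum>e \<in> edges M. (\<Sum>k \<in> lanes.
      (lane_flow M z (e, k, t) - lane_flow M y (e, k, t)) * latency M e (lane_flow M y (e, k, t)))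
    + (\<Sum>g \<in> groups_on M e.
      (z (e, 1, t, g) - y (e, 1, t, g)) * toll M \<tau> \<alpha> e t g / value_of_time M g t))"
    if t: "t \<in> periods M" for t
  proof -
    define \<delta> where "\<delta> e k g = z (e, k, t, g) - y (e, k, t, g)" for e k g
    define l where "l e k = latency M e (lane_flow M y (e, k, t))" for e k
    define v where "v g = value_of_time M g t" for g
    have v: "v g \<noteq> 0" if "g \<in> groups M" for g
      using value_of_time_pos[OF that t] by (simp add: v_def)
    have lane: "lane_flow M z (e, k, t) - lane_flow M y (e, k, t) = (\<Sum>g \<in> groups_on M e. \<delta> e k g)"
      if "e \<in> edges M" "k \<in> lanes" for e k
      using that t by (simp add: lane_flow_apply \<delta>_def sum_subtractf)
    have "(\<Sum>g \<in> groups M. deviation_cost M \<tau> \<alpha> y z t g / value_of_time M g t) =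
      (\<Sum>g \<in> groups M. \<Sum>e \<in> {e \<in> edges M. g \<in> groups_on M e}. \<Sum>k \<in> lanes.
        \<delta> e k g * cost M \<tau> \<alpha> y e k t g / v g)"
      by (simp only: deviation_cost_def sum_divide_distrib \<delta>_def v_def)
    also have "\<dots> = (\<Sum>e \<in> edges M. \<Sum>g \<in> {g \<in> groups M. g \<in> groups_on M e}. \<Sum>k \<in> lanes.
        \<delta> e k g * cost M \<tau> \<alpha> y e k t g / v g)"
      by (rule sum.swap_restrict[OF finite_groups finite_edges])
    also have "\<dots> = (\<Sum>e \<in> edges M. \<Sum>g \<in> groups_on M e.
        (\<Sum>k \<in> lanes. \<delta> e k g * l e k) + \<delta> e 1 g * toll M \<tau> \<alpha> e t g / v g)"
    proof (intro sum.cong refl)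
      show "{g \<in> groups M. g \<in> groups_on M e} = groups_on M e" for e
        using groups_on_subset by blast
      fix e g assume "g \<in> groups_on M e"
      then have "v g \<noteq> 0" using groups_on_subset v by blast
      \<comment> \<open>\<open>cost\<close> contains a toll on lane 1 only, hence the single toll
        term.\<close>
      then show "(\<Sum>k \<in> lanes. \<delta> e k g * cost M \<tau> \<alpha> y e k t g / v g) =
        (\<Sum>k \<in> lanes. \<delta> e k g * l e k) + \<delta> e 1 g * toll M \<tau> \<alpha> e t g / v g"
        by (simp add: cost_def toll_def l_def v_def[symmetric] field_simps)
    qed
    also have "\<dots> = (\<Sum>e \<in> edges M. (\<Sum>k \<in> lanes. (\<Sum>g \<in> groups_on M e. \<delta> e k g) * l e k)
        + (\<Sum>g \<in> groups_on M e. \<delta> e 1 g * toll M \<tau> \<alpha> e t g / v g))"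
      by (simp add: sum.distrib sum_distrib_right)
    finally show ?thesis
      by (simp add: lane l_def[symmetric] \<delta>_def[symmetric] v_def[symmetric])
  qed
  then show ?thesis
    by (simp add: toll_change_def sum.distrib)
qed

text \<open>By \<open>sum_deviation_cost\<close> the right-hand side is a sum over periods and
  groups with positive weights. As each pair can deviate on its own, that one inequality for all
  \<open>z\<close> is equivalent to nonnegativity of every summand.\<close>

lemma dbcp_equilibrium_iff_variational:
  assumes "y \<in> admissible M"
  shows "dbcp_equilibrium M \<tau> \<alpha> y \<longleftrightarrow>
    (\<forall>z \<in> admissible M. 0 \<le> (\<Sum>t \<in> periods M. \<Sum>e \<in> edges M. \<Sum>k \<in> lanes.
      (lane_flow M z (e, k, t) - lane_flow M y (e, k, t)) * latency M e (lane_flow M y (e, k, t)))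
      + toll_change \<tau> \<alpha> y z)"
    (is "_ \<longleftrightarrow> ?R")
proof
  assume E: "dbcp_equilibrium M \<tau> \<alpha> y"
  show ?R
    unfolding sum_deviation_cost[symmetric]
    using E value_of_time_pos
    by (auto simp: dbcp_equilibrium_iff_deviation_cost[OF assms]
        intro!: sum_nonneg divide_nonneg_pos)
next
  assume R: ?R
  show "dbcp_equilibrium M \<tau> \<alpha> y"
    unfolding dbcp_equilibrium_iff_deviation_cost[OF assms]
  proof (intro ballI)
    fix z g t assume z: "z \<in> admissible M" and g: "g \<in> groups M" and t: "t \<in> periods M"
    \<comment> \<open>With this weight only group \<open>g\<close> deviates, and only in period
      \<open>t\<close>; all other summands vanish.\<close>
    define w :: "nat \<Rightarrow> 'g \<Rightarrow> real" where "w s h = of_bool (s = t) * of_bool (h = g)" for s h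
    define u where "u = mix M w y z"
    have "u \<in> admissible M" unfolding u_def using assms z by (intro mix_admissible) (auto simp: w_def)
    with R have "0 \<le> (\<Sum>s \<in> periods M. \<Sum>h \<in> groups M.
        deviation_cost M \<tau> \<alpha> y u s h / value_of_time M h s)"
      unfolding sum_deviation_cost by blast
    also have "\<dots> = (\<Sum>s \<in> periods M. of_bool (s = t) * (\<Sum>h \<in> groups M. of_bool (h = g) *
        (deviation_cost M \<tau> \<alpha> y z s h / value_of_time M h s)))"
      unfolding u_def sum_distrib_left
      by (intro sum.cong refl) (simp add: deviation_cost_mix w_def)
    also have "\<dots> = deviation_cost M \<tau> \<alpha> y z t g / value_of_time M g t"
      using t g finite_groups by (simp add: sum.remove[of _ t] sum.remove[of _ g])
    finally show "0 \<le> deviation_cost M \<tau> \<alpha> y z t g"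
      using value_of_time_pos[OF g t] by (simp add: zero_le_divide_iff)
  qed
qed

section \<open>Minimizers solve the variational inequality\<close>

lemma variational_if_minimizer:
  assumes y: "y \<in> admissible M" and z: "z \<in> admissible M"
    and min: "\<And>u. u \<in> admissible M \<Longrightarrow> potential \<tau> \<alpha> y \<le> potential \<tau> \<alpha> u"
  shows "0 \<le> (\<Sum>t \<in> periods M. \<Sum>e \<in> edges M. \<Sum>k \<in> lanes.
      (lane_flow M z (e, k, t) - lane_flow M y (e, k, t)) * latency M e (lane_flow M y (e, k, t)))
      + toll_change \<tau> \<alpha> y z"
proof -
  have fl: "y \<in> flows M" "z \<in> flows M" using y z by (auto simp: admissible_def)
  define a where "a e k t = lane_flow M y (e, k, t)" for e k t
  define d where "d e k t = lane_flow M z (e, k, t) - lane_flow M y (e, k, t)" for e k t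
  \<comment> \<open>\<open>s * D s\<close> is the upper bound of \<open>potential_diff_le\<close> on
    the increase from \<open>y\<close> to the point at parameter \<open>s\<close> of the segment;
    \<open>D 0\<close> is the expression in the claim.\<close>
  define D where "D s = (\<Sum>t \<in> periods M. \<Sum>e \<in> edges M. \<Sum>k \<in> lanes.
      d e k t * latency M e (a e k t + s * d e k t)) + toll_change \<tau> \<alpha> y z" for s
  have D_nonneg: "0 \<le> D s" if s: "0 < s" "s \<le> 1" for s
  proof -
    define u where "u = mix M (\<lambda>_ _. s) y z"
    have u: "u \<in> admissible M" unfolding u_def using y z s by (intro mix_admissible) auto
    have "0 \<le> potential \<tau> \<alpha> u - potential \<tau> \<alpha> y" using min[OF u] by simp
    also have "\<dots> \<le> (\<Sum>t \<in> periods M. \<Sum>e \<in> edges M. \<Sum>k \<in> lanes.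
        (lane_flow M u (e, k, t) - lane_flow M y (e, k, t)) * latency M e (lane_flow M u (e, k, t)))
        + toll_change \<tau> \<alpha> y u"
      using u fl by (intro potential_diff_le) (auto simp: admissible_def)
    also have "\<dots> = (\<Sum>t \<in> periods M. \<Sum>e \<in> edges M. \<Sum>k \<in> lanes.
        s * (d e k t * latency M e (a e k t + s * d e k t))) + s * toll_change \<tau> \<alpha> y z"
      unfolding u_def toll_change_mix
      by (intro arg_cong2[where f = "(+)"] sum.cong refl) (simp add: lane_flow_mix a_def d_def)
    also have "\<dots> = s * D s"
      by (simp only: D_def sum_distrib_left distrib_left)
    finally show ?thesis using s by (simp add: zero_le_mult_iff)
  qed
  \<comment> \<open>Latencies are known to be continuous on the nonnegative half-line only, so the
    lane flows along the whole segment must stay in it.\<close>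
  have pos: "0 \<le> a e k t + s * d e k t"
    if "e \<in> edges M" "k \<in> lanes" "t \<in> periods M" "s \<in> {0..1}" for e k t s
  proof -
    have "0 \<le> lane_flow M (mix M (\<lambda>_ _. s) y z) (e, k, t)"
      using that fl by (intro lane_flow_nonneg mix_flows) auto
    then show ?thesis using that by (simp add: lane_flow_mix a_def d_def)
  qed
  have "continuous_on {0..1} D"
    unfolding D_def
    by (intro continuous_intros continuous_on_compose2[OF latency_continuous_on])
      (use pos in auto)
  then have "(D \<longlongrightarrow> D 0) (at 0 within {0..1})"
    by (simp add: continuous_on_def)
  then have "(D \<longlongrightarrow> D 0) (at_right 0)"
    by (simp add: at_within_Icc_at_right)
  moreover have "eventually (\<lambda>s. 0 \<le> D s) (at_right 0)"
    using D_nonneg by (auto simp: eventually_at_right_field intro!: exI[of _ 1])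
  ultimately have "0 \<le> D 0"
    by (intro tendsto_lowerbound) auto
  then show ?thesis by (simp add: D_def a_def d_def)
qed

end

theorem proposition4p3:
  fixes M :: "('i, 'e, 'g) model"
    and \<tau> \<alpha> :: "'e \<Rightarrow> nat \<Rightarrow> real"
    and y' :: "('e, 'g) flow"
  assumes "valid_model M"
    and "is_policy M \<tau> \<alpha>"
    and "y' \<in> admissible M"
  shows "dbcp_equilibrium M \<tau> \<alpha> y' \<longleftrightarrow>
    is_arg_min (program_objective M \<tau> \<alpha>) (program_feasible M) (y', lane_flow M y')"
proof -
  interpret valid_model M by fact
  have "is_arg_min (program_objective M \<tau> \<alpha>) (program_feasible M) (y', lane_flow M y') \<longleftrightarrow>
      (\<forall>z \<in> admissible M. potential \<tau> \<alpha> y' \<le> potential \<tau> \<alpha> z)"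
    using assms(3)
    by (auto simp: is_arg_min_def program_feasible_iff potential_def not_less)
  also have "\<dots> \<longleftrightarrow> dbcp_equilibrium M \<tau> \<alpha> y'"
  proof
    assume "\<forall>z \<in> admissible M. potential \<tau> \<alpha> y' \<le> potential \<tau> \<alpha> z"
    then show "dbcp_equilibrium M \<tau> \<alpha> y'"
      using variational_if_minimizer assms(3)
      by (simp add: dbcp_equilibrium_iff_variational)
  next
    assume E: "dbcp_equilibrium M \<tau> \<alpha> y'"
    show "\<forall>z \<in> admissible M. potential \<tau> \<alpha> y' \<le> potential \<tau> \<alpha> z"
    proof
      fix z assume z: "z \<in> admissible M"
      \<comment> \<open>The lower bound in \<open>potential_diff_ge\<close> is the variational
        expression, which is nonnegative at an equilibrium.\<close>
      have "0 \<le> potential \<tau> \<alpha> z - potential \<tau> \<alpha> y'"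
        using E z assms(3) potential_diff_ge[of y' z \<tau> \<alpha>]
        by (fastforce simp: dbcp_equilibrium_iff_variational admissible_def)
      then show "potential \<tau> \<alpha> y' \<le> potential \<tau> \<alpha> z" by simp
    qed
  qed
  finally show ?thesis by blast
qed

end
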